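(* Let $\lambda\ge0$ be a random variable and suppose that for some $\alpha>0$, $t_0\ge1$ and $C>0$, $\Pr(\lambda\ge t)\le Ct^{-\alpha}$ for all $t\ge t_0$. Then $\mathbb E\log(1+\lambda^2)<\infty$. Moreover, for every $c>0$, \[ \mathbb E\log(1+c\lambda^2)\le\log(1+c)+\log(1+t_0^2)+\frac{2C}{\alpha}t_0^{-\alpha}. \] Consequently, in the scalar scale-mixture model $\theta\mid\lambda\sim N(0,\lambda^2)$, $Y\mid\theta,\lambda\sim N(\theta,\sigma^2/n)$ with $c=n/\sigma^2$, \[ I(\theta;Y\mid\lambda)=\frac12\,\mathbb E_\lambda\log(1+c\lambda^2)<\infty, \] and $I(\theta;Y\mid\lambda)=O(\log c)$ as $c\to\infty$ (with the law of $\lambda$ fixed).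
   Context: $I(\theta;Y\mid\lambda)$ is the conditional mutual information (natural logarithm): the average over the law of $\lambda$ of the mutual information $\mathrm{KL}(P_{\theta,Y\mid\lambda}\,\|\,P_{\theta\mid\lambda}\otimes P_{Y\mid\lambda})$ between $\theta$ and $Y$ under their conditional joint law given $\lambda$. Here $\sigma>0$, $n>0$. *)

theory Defs
  imports "HOL-Probability.Probability"
begin

text \<open>
  Kullback-Leibler divergence \<open>KL(P || Q)\<close> of probability measures, in nats and with values in
  \<open>[0, \<infinity>]\<close>. The library's \<open>KL_divergence b Q P\<close> (reference measure first) is a Bochner integral,
  hence only meaningful if \<open>P\<close> is absolutely continuous with respect to \<open>Q\<close> and the log-density is
  \<open>P\<close>-integrable. As the negative part of the log-density is always \<open>P\<close>-integrable, the divergence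
  is infinite in all other cases.
\<close>

definition KL :: "'a measure \<Rightarrow> 'a measure \<Rightarrow> ennreal" where
  "KL P Q =
    (if absolutely_continuous Q P \<and> integrable P (entropy_density (exp 1) Q P)
     then ennreal (KL_divergence (exp 1) Q P) else \<infinity>)"

definition mutual_info :: "(real \<times> real) measure \<Rightarrow> ennreal" where
  "mutual_info J = KL J (distr J borel fst \<Otimes>\<^sub>M distr J borel snd)"

text \<open>\<open>K\<close> is a regular conditional distribution of \<open>X\<close> given \<open>Z\<close>.\<close>

definition has_cond_law ::
  "'a measure \<Rightarrow> 'x measure \<Rightarrow> ('a \<Rightarrow> 'x) \<Rightarrow> 'z measure \<Rightarrow> ('a \<Rightarrow> 'z) \<Rightarrow> ('z \<Rightarrow> 'x measure) \<Rightarrow> bool"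
where
  "has_cond_law M S X T Z K \<longleftrightarrow>
     X \<in> measurable M S \<and> Z \<in> measurable M T \<and> K \<in> measurable T (prob_algebra S) \<and>
     (\<forall>A\<in>sets T. \<forall>B\<in>sets S.
        emeasure M {\<omega>\<in>space M. Z \<omega> \<in> A \<and> X \<omega> \<in> B} = (\<integral>\<^sup>+z\<in>A. emeasure (K z) B \<partial>distr M T Z))"

text \<open>
  \<open>I(X; Y | Z)\<close>. The choice of the version of the conditional law is immaterial: on real pairs, two
  versions agree for almost every \<open>z\<close>. The library's \<open>conditional_mutual_information\<close> is not
  used, because it is a difference of two unconditional mutual informations that may both be
  infinite here.
\<close>

definition cond_mutual_info ::
  "'a measure \<Rightarrow> ('a \<Rightarrow> real) \<Rightarrow> ('a \<Rightarrow> real) \<Rightarrow> ('a \<Rightarrow> real) \<Rightarrow> ennreal"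
where
  "cond_mutual_info M X Y Z =
     (let K = (SOME K. has_cond_law M (borel \<Otimes>\<^sub>M borel) (\<lambda>\<omega>. (X \<omega>, Y \<omega>)) borel Z K)
      in \<integral>\<^sup>+z. mutual_info (K z) \<partial>distr M borel Z)"

text \<open>\<open>N(m, v)\<close> with \<open>v\<close> the variance; \<open>N(m, 0)\<close> is the point mass at \<open>m\<close>.\<close>

definition normal_law :: "real \<Rightarrow> real \<Rightarrow> real measure" where
  "normal_law m v =
     (if v = 0 then return borel m
      else density lborel (\<lambda>x. ennreal (normal_density m (sqrt v) x)))"

definition scale_mixture_model ::
  "'a measure \<Rightarrow> ('a \<Rightarrow> real) \<Rightarrow> ('a \<Rightarrow> real) \<Rightarrow> ('a \<Rightarrow> real) \<Rightarrow> real \<Rightarrow> real \<Rightarrow> bool"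
where
  "scale_mixture_model M lam \<theta> Y \<sigma> n \<longleftrightarrow>
     prob_space M \<and> \<sigma> > 0 \<and> n > 0 \<and>
     has_cond_law M borel \<theta> borel lam (\<lambda>l. normal_law 0 (l\<^sup>2)) \<and>
     has_cond_law M borel Y (borel \<Otimes>\<^sub>M borel) (\<lambda>\<omega>. (\<theta> \<omega>, lam \<omega>))
       (\<lambda>(t, l). normal_law t (\<sigma>\<^sup>2 / n))"

end

theory Submission
  imports Defs
begin

text \<open>
  Since \<open>ln (1 + x\<^sup>2)\<close> exceeds \<open>ln (1 + t0\<^sup>2)\<close> by at most the integral of \<open>2 / t\<close> over \<open>[t0, x]\<close>, Fubini
  turns the tail bound into the moment bound; the constant \<open>c\<close> is split off by
  \<open>1 + c x\<^sup>2 \<le> (1 + c) (1 + x\<^sup>2)\<close>.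

  For the information identity, composing the two Gaussian kernels gives a conditional law of
  \<open>(\<theta>, Y)\<close> given \<open>\<lambda>\<close>. Conditional laws on a second-countable space are almost surely unique, as they
  agree on a countable generator closed under intersection, so this version may be used to compute
  the conditional mutual information. With noise variance \<open>v\<close>, the joint law given \<open>\<lambda> = z\<close> has density
  \<open>N(x, v)(y) / N(0, z\<^sup>2 + v)(y)\<close> with respect to the product of its marginals, even when \<open>z = 0\<close> and
  the law of \<open>\<theta>\<close> is degenerate. In the expected log-density the two quadratic terms cancel because
  \<open>E (Y - \<theta>)\<^sup>2 = v\<close> and \<open>E Y\<^sup>2 = z\<^sup>2 + v\<close>.
\<close>

section \<open>Conditional laws\<close>

lemma has_cond_law_kernel:
  assumes "has_cond_law M S X T Z K" "z \<in> space T"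
  shows "prob_space (K z)" "sets (K z) = sets S" "space (K z) = space S"
proof -
  have "K z \<in> space (prob_algebra S)"
    using assms unfolding has_cond_law_def by (auto intro: measurable_space)
  then show "prob_space (K z)" "sets (K z) = sets S"
    by (auto simp: space_prob_algebra)
  then show "space (K z) = space S"
    by (auto dest: sets_eq_imp_space_eq)
qed

text \<open>Both sides integrate \<open>f\<close> against a measure on the product: the joint law of
  \<open>X\<close> and \<open>Z\<close>, and the mixture of the kernels over the law of
  \<open>Z\<close>. The defining equation of a conditional law is their equality on rectangles, and
  rectangles form an intersection-stable generator, so the finite measures coincide.\<close>

lemma has_cond_law_nn_integral:
  assumes M: "prob_space M" and c: "has_cond_law M S X T Z K"
    and f: "f \<in> borel_measurable (S \<Otimes>\<^sub>M T)"
  shows "(\<integral>\<^sup>+\<omega>. f (X \<omega>, Z \<omega>) \<partial>M) = (\<integral>\<^sup>+z. \<integral>\<^sup>+x. f (x, z) \<partial>K z \<partial>distr M T Z)"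
proof -
  interpret prob_space M by fact
  have [measurable]: "X \<in> measurable M S" "Z \<in> measurable M T" "K \<in> measurable T (prob_algebra S)"
    and eq: "\<And>A B. A \<in> sets T \<Longrightarrow> B \<in> sets S \<Longrightarrow>
      emeasure M {\<omega>\<in>space M. Z \<omega> \<in> A \<and> X \<omega> \<in> B} = (\<integral>\<^sup>+z\<in>A. emeasure (K z) B \<partial>distr M T Z)"
    using c by (auto simp: has_cond_law_def)
  note Kp = has_cond_law_kernel[OF c]
  let ?\<mu> = "distr M T Z" and ?P = "S \<Otimes>\<^sub>M T"
  \<comment> \<open>Each \<open>K z\<close> is moved to the slice over \<open>z\<close>, so that
    mixing over \<open>z\<close> yields one measure on the product.\<close>
  define L where "L z = distr (K z) ?P (\<lambda>x. (x, z))" for z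
  have L: "L \<in> measurable T (prob_algebra ?P)"
    unfolding L_def by measurable
  have L': "L \<in> measurable ?\<mu> (subprob_algebra ?P)"
    using measurable_prob_algebraD[OF L] by simp
  \<comment> \<open>A bind over an empty space is a default value; a value of \<open>Z\<close>
    excludes this case.\<close>
  have ne: "space ?\<mu> \<noteq> {}"
    using not_empty measurable_space[of Z M T] by auto
  have "distr M ?P (\<lambda>\<omega>. (X \<omega>, Z \<omega>)) = ?\<mu> \<bind> L"
  proof (rule measure_eqI_generator_eq[OF Int_stable_pair_measure_generator[of S T],
        where \<Omega> = "space S \<times> space T" and A = "\<lambda>_. space S \<times> space T"])
    show "{a \<times> b |a b. a \<in> sets S \<and> b \<in> sets T} \<subseteq> Pow (space S \<times> space T)"
      by (auto dest: sets.sets_into_space)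
    show "sets (distr M ?P (\<lambda>\<omega>. (X \<omega>, Z \<omega>))) =
        sigma_sets (space S \<times> space T) {a \<times> b |a b. a \<in> sets S \<and> b \<in> sets T}"
      by (simp add: sets_pair_measure)
    show "sets (?\<mu> \<bind> L) = sigma_sets (space S \<times> space T) {a \<times> b |a b. a \<in> sets S \<and> b \<in> sets T}"
      using sets_bind_measurable[OF L' ne] by (simp add: sets_pair_measure)
    interpret X: prob_space "distr M ?P (\<lambda>\<omega>. (X \<omega>, Z \<omega>))" by (rule prob_space_distr) measurable
    show "emeasure (distr M ?P (\<lambda>\<omega>. (X \<omega>, Z \<omega>))) (space S \<times> space T) \<noteq> \<infinity>"
      by simp
    fix W assume "W \<in> {a \<times> b |a b. a \<in> sets S \<and> b \<in> sets T}"
    then obtain a b where [measurable]: "a \<in> sets S" "b \<in> sets T" and W: "W = a \<times> b" by auto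
    have "emeasure (distr M ?P (\<lambda>\<omega>. (X \<omega>, Z \<omega>))) W = emeasure M {\<omega>\<in>space M. Z \<omega> \<in> b \<and> X \<omega> \<in> a}"
      unfolding W by (subst emeasure_distr) (auto intro!: arg_cong[where f="emeasure M"])
    also have "\<dots> = (\<integral>\<^sup>+z\<in>b. emeasure (K z) a \<partial>?\<mu>)" by (rule eq) auto
    also have "\<dots> = (\<integral>\<^sup>+z. emeasure (L z) W \<partial>?\<mu>)"
    proof (rule nn_integral_cong)
      fix z assume "z \<in> space ?\<mu>"
      then have z: "z \<in> space T" by simp
      have "(\<lambda>x. (x, z)) -` W \<inter> space S = (if z \<in> b then a else {})"
        using sets.sets_into_space[of a S] unfolding W by auto
      moreover have "(\<lambda>x. (x, z)) \<in> measurable (K z) ?P"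
        using z by (simp add: measurable_cong_sets[OF Kp(2)[OF z] refl])
      ultimately show "emeasure (K z) a * indicator b z = emeasure (L z) W"
        unfolding L_def by (subst emeasure_distr) (auto simp: W Kp[OF z])
    qed
    also have "\<dots> = emeasure (?\<mu> \<bind> L) W"
      by (rule emeasure_bind[symmetric, OF ne L']) (auto simp: W)
    finally show "emeasure (distr M ?P (\<lambda>\<omega>. (X \<omega>, Z \<omega>))) W = emeasure (?\<mu> \<bind> L) W" .
  qed auto
  then have "(\<integral>\<^sup>+\<omega>. f (X \<omega>, Z \<omega>) \<partial>M) = (\<integral>\<^sup>+w. f w \<partial>(?\<mu> \<bind> L))"
    using f by (simp add: nn_integral_distr flip: \<open>distr M ?P _ = _\<close>)
  also have "\<dots> = (\<integral>\<^sup>+z. \<integral>\<^sup>+w. f w \<partial>L z \<partial>?\<mu>)"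
    by (rule nn_integral_bind[OF f L'])
  also have "\<dots> = (\<integral>\<^sup>+z. \<integral>\<^sup>+x. f (x, z) \<partial>K z \<partial>?\<mu>)"
  proof (rule nn_integral_cong)
    fix z assume "z \<in> space ?\<mu>"
    then have z: "z \<in> space T" by simp
    have "(\<lambda>x. (x, z)) \<in> measurable (K z) ?P"
      using z by (simp add: measurable_cong_sets[OF Kp(2)[OF z] refl])
    then show "(\<integral>\<^sup>+w. f w \<partial>L z) = (\<integral>\<^sup>+x. f (x, z) \<partial>K z)"
      unfolding L_def by (subst nn_integral_distr) (use f in auto)
  qed
  finally show ?thesis .
qed

text \<open>Chain rule: given \<open>z\<close>, draw \<open>x\<close> from \<open>K z\<close>, then
  \<open>y\<close> from \<open>L (x, z)\<close>. Integration against a conditional law is used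
  twice, to eliminate \<open>Y\<close> given the pair of \<open>X\<close> and \<open>Z\<close>, and
  then \<open>X\<close> given \<open>Z\<close>.\<close>

lemma has_cond_law_compose:
  assumes M: "prob_space M" and K: "has_cond_law M S X T Z K"
    and L: "has_cond_law M R Y (S \<Otimes>\<^sub>M T) (\<lambda>\<omega>. (X \<omega>, Z \<omega>)) L"
  shows "has_cond_law M (S \<Otimes>\<^sub>M R) (\<lambda>\<omega>. (X \<omega>, Y \<omega>)) T Z
    (\<lambda>z. K z \<bind> (\<lambda>x. distr (L (x, z)) (S \<Otimes>\<^sub>M R) (Pair x)))"
proof -
  interpret prob_space M by fact
  have [measurable]: "X \<in> measurable M S" "Z \<in> measurable M T" "K \<in> measurable T (prob_algebra S)"
     "Y \<in> measurable M R" "L \<in> measurable (S \<Otimes>\<^sub>M T) (prob_algebra R)"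
    using K L by (auto simp: has_cond_law_def)
  let ?J = "\<lambda>z. K z \<bind> (\<lambda>x. distr (L (x, z)) (S \<Otimes>\<^sub>M R) (Pair x))"
  have L2: "(\<lambda>x. distr (L (x, z)) (S \<Otimes>\<^sub>M R) (Pair x)) \<in> measurable S (prob_algebra (S \<Otimes>\<^sub>M R))"
    if [measurable]: "z \<in> space T" for z by measurable
  have J: "?J \<in> measurable T (prob_algebra (S \<Otimes>\<^sub>M R))" by measurable
  have "emeasure M {\<omega>\<in>space M. Z \<omega> \<in> A \<and> (X \<omega>, Y \<omega>) \<in> B} = (\<integral>\<^sup>+z\<in>A. emeasure (?J z) B \<partial>distr M T Z)"
    if [measurable]: "A \<in> sets T" "B \<in> sets (S \<Otimes>\<^sub>M R)" for A B
  proof -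
    \<comment> \<open>The variables are nested as \<open>(y, x, z)\<close> because \<open>L\<close>
      conditions on the pair \<open>(x, z)\<close>.\<close>
    define f :: "_ \<Rightarrow> ennreal" where "f = (\<lambda>(y, x, z). indicator A z * indicator B (x, y))"
    have f[measurable]: "f \<in> borel_measurable (R \<Otimes>\<^sub>M (S \<Otimes>\<^sub>M T))" unfolding f_def by measurable
    \<comment> \<open>What remains of the event once \<open>y\<close> is averaged out; it depends on
      \<open>x\<close> and \<open>z\<close> only, so the kernel \<open>K\<close> can be applied
      next.\<close>
    define g where "g w = (\<integral>\<^sup>+y. f (y, w) \<partial>L w)" for w
    have g[measurable]: "g \<in> borel_measurable (S \<Otimes>\<^sub>M T)"
      unfolding g_def
      by (rule nn_integral_measurable_subprob_algebra2[where N=R])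
        (auto intro!: measurable_prob_algebraD)
    have "emeasure M {\<omega>\<in>space M. Z \<omega> \<in> A \<and> (X \<omega>, Y \<omega>) \<in> B} = (\<integral>\<^sup>+\<omega>. f (Y \<omega>, X \<omega>, Z \<omega>) \<partial>M)"
    proof -
      have [measurable]: "{\<omega>\<in>space M. Z \<omega> \<in> A \<and> (X \<omega>, Y \<omega>) \<in> B} \<in> sets M" by measurable
      have "(\<integral>\<^sup>+\<omega>. f (Y \<omega>, X \<omega>, Z \<omega>) \<partial>M) =
          (\<integral>\<^sup>+\<omega>. indicator {\<omega>\<in>space M. Z \<omega> \<in> A \<and> (X \<omega>, Y \<omega>) \<in> B} \<omega> \<partial>M)"
        by (intro nn_integral_cong) (auto simp: f_def split: split_indicator)
      then show ?thesis by simp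
    qed
    also have "\<dots> = (\<integral>\<^sup>+w. g w \<partial>distr M (S \<Otimes>\<^sub>M T) (\<lambda>\<omega>. (X \<omega>, Z \<omega>)))"
      unfolding g_def by (rule has_cond_law_nn_integral[OF M L f])
    also have "\<dots> = (\<integral>\<^sup>+\<omega>. g (X \<omega>, Z \<omega>) \<partial>M)" by (subst nn_integral_distr) auto
    also have "\<dots> = (\<integral>\<^sup>+z. \<integral>\<^sup>+x. g (x, z) \<partial>K z \<partial>distr M T Z)"
      by (rule has_cond_law_nn_integral[OF M K g])
    also have "\<dots> = (\<integral>\<^sup>+z\<in>A. emeasure (?J z) B \<partial>distr M T Z)"
    proof (rule nn_integral_cong)
      fix z assume "z \<in> space (distr M T Z)"
      then have z[measurable]: "z \<in> space T" by simp
      have Kz: "K z \<in> space (prob_algebra S)" by (auto intro: measurable_space)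
      have "g (x, z) = indicator A z * emeasure (distr (L (x, z)) (S \<Otimes>\<^sub>M R) (Pair x)) B"
        if x: "x \<in> space S" for x
      proof -
        have w: "(x, z) \<in> space (S \<Otimes>\<^sub>M T)" using x z by (simp add: space_pair_measure)
        note Lp = has_cond_law_kernel[OF L w]
        have [measurable]: "Pair x \<in> measurable (L (x, z)) (S \<Otimes>\<^sub>M R)"
          using x by (simp add: measurable_cong_sets[OF Lp(2) refl])
        have "g (x, z) = (\<integral>\<^sup>+y. indicator A z * indicator B (x, y) \<partial>L (x, z))"
          by (simp add: g_def f_def)
        also have "\<dots> = indicator A z * (\<integral>\<^sup>+y. indicator B (x, y) \<partial>L (x, z))"
          by (rule nn_integral_cmult) measurable
        also have "(\<integral>\<^sup>+y. indicator B (x, y) \<partial>L (x, z)) = (\<integral>\<^sup>+w. indicator B w \<partial>distr (L (x, z)) (S \<Otimes>\<^sub>M R) (Pair x))"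
          by (subst nn_integral_distr) auto
        finally show ?thesis by simp
      qed
      then have "(\<integral>\<^sup>+x. g (x, z) \<partial>K z) =
          (\<integral>\<^sup>+x. indicator A z * emeasure (distr (L (x, z)) (S \<Otimes>\<^sub>M R) (Pair x)) B \<partial>K z)"
        by (intro nn_integral_cong) (simp add: has_cond_law_kernel[OF K z])
      also have "\<dots> = indicator A z * (\<integral>\<^sup>+x. emeasure (distr (L (x, z)) (S \<Otimes>\<^sub>M R) (Pair x)) B \<partial>K z)"
      proof (rule nn_integral_cmult)
        have "(\<lambda>x. emeasure (distr (L (x, z)) (S \<Otimes>\<^sub>M R) (Pair x)) B) \<in> borel_measurable S"
          using measurable_emeasure_kernel[OF measurable_prob_algebraD[OF L2[OF z]]] by simp
        then show "(\<lambda>x. emeasure (distr (L (x, z)) (S \<Otimes>\<^sub>M R) (Pair x)) B) \<in> borel_measurable (K z)"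
          by (simp add: measurable_cong_sets[OF has_cond_law_kernel(2)[OF K z] refl])
      qed
      also have "(\<integral>\<^sup>+x. emeasure (distr (L (x, z)) (S \<Otimes>\<^sub>M R) (Pair x)) B \<partial>K z) = emeasure (?J z) B"
        by (rule emeasure_bind_prob_algebra[symmetric, OF Kz L2[OF z]]) auto
      finally show "(\<integral>\<^sup>+x. g (x, z) \<partial>K z) = emeasure (?J z) B * indicator A z"
        by (simp add: mult.commute)
    qed
    finally show ?thesis .
  qed
  then show ?thesis using J by (auto simp: has_cond_law_def)
qed

text \<open>A countable basis generates the Borel sets but need not be closed under intersection.
  Its finite intersections are, and they remain countable and open; the empty intersection
  contributes \<open>UNIV\<close>.\<close>

lemma borel_countable_Int_stable_generator:
  obtains G :: "'a::second_countable_topology set set"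
  where "countable G" "Int_stable G" "UNIV \<in> G" "sets borel = sigma_sets UNIV G"
proof -
  obtain B :: "'a set set" where B: "countable B" "topological_basis B"
    using ex_countable_basis by auto
  define G where "G = Inter ` {F. finite F \<and> F \<subseteq> B}"
  have "countable G" unfolding G_def using B by (intro countable_image countable_Collect_finite_subset)
  moreover have "Int_stable G"
  proof (rule Int_stableI)
    fix a b assume "a \<in> G" "b \<in> G"
    then obtain E F where "finite E" "E \<subseteq> B" "a = \<Inter>E" "finite F" "F \<subseteq> B" "b = \<Inter>F"
      by (auto simp: G_def)
    then have "a \<inter> b = \<Inter>(E \<union> F)" "finite (E \<union> F)" "E \<union> F \<subseteq> B" by auto
    then show "a \<inter> b \<in> G" unfolding G_def by blast
  qed
  moreover have "UNIV \<in> G"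
    unfolding G_def by (rule image_eqI[of _ _ "{}"]) auto
  moreover have "sets borel = sigma_sets UNIV G"
  proof -
    have borel: "sets borel = sigma_sets UNIV B"
      by (subst borel_eq_countable_basis[OF B]) simp
    have "B \<subseteq> G"
    proof
      fix b assume "b \<in> B"
      then show "b \<in> G" unfolding G_def by (intro image_eqI[of _ _ "{b}"]) auto
    qed
    moreover have "G \<subseteq> sets borel"
    proof
      fix b assume "b \<in> G"
      then obtain F where F: "finite F" "F \<subseteq> B" "b = \<Inter>F" by (auto simp: G_def)
      with B have "open b" by (auto intro!: open_Inter dest: topological_basis_open)
      then show "b \<in> sets borel" by simp
    qed
    ultimately show ?thesis
      unfolding borel by (intro sigma_sets_eqI) auto
  qed
  ultimately show ?thesis by (rule that)
qed

text \<open>For fixed \<open>B\<close>, both \<open>emeasure (K z) B\<close> and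
  \<open>emeasure (K' z) B\<close> are densities, with respect to the law of \<open>Z\<close>, of
  the same finite measure, so they agree almost everywhere. Countability of the generator merges the
  exceptional sets into one null set, outside which the two kernels agree on a generator and hence
  everywhere.\<close>

lemma has_cond_law_unique:
  fixes X :: "'a \<Rightarrow> 'x::second_countable_topology"
  assumes M: "prob_space M" and S: "sets S = sets borel"
    and K: "has_cond_law M S X T Z K" and K': "has_cond_law M S X T Z K'"
  shows "AE z in distr M T Z. K z = K' z"
proof -
  interpret prob_space M by fact
  have [measurable]: "Z \<in> measurable M T" "K \<in> measurable T (prob_algebra S)"
      "K' \<in> measurable T (prob_algebra S)"
    using K K' by (auto simp: has_cond_law_def)
  interpret Z: prob_space "distr M T Z" by (rule prob_space_distr) measurable
  obtain G :: "'x set set" where G: "countable G" "Int_stable G" "UNIV \<in> G" "sets borel = sigma_sets UNIV G"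
    by (rule borel_countable_Int_stable_generator)
  have "AE z in distr M T Z. emeasure (K z) B = emeasure (K' z) B" if "B \<in> G" for B
  proof -
    have [measurable]: "B \<in> sets S" using that G S by (auto intro: sigma_sets.Basic)
    show ?thesis
    proof (rule Z.density_unique_finite_measure)
      show "(\<lambda>z. emeasure (K z) B) \<in> borel_measurable (distr M T Z)"
        using measurable_emeasure_kernel[of K T S B] by (simp add: measurable_prob_algebraD)
      show "(\<lambda>z. emeasure (K' z) B) \<in> borel_measurable (distr M T Z)"
        using measurable_emeasure_kernel[of K' T S B] by (simp add: measurable_prob_algebraD)
      fix A assume "A \<in> sets (distr M T Z)"
      then have A: "A \<in> sets T" by simp
      have "emeasure M {\<omega>\<in>space M. Z \<omega> \<in> A \<and> X \<omega> \<in> B} = (\<integral>\<^sup>+z\<in>A. emeasure (K z) B \<partial>distr M T Z)"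
        using K A \<open>B \<in> sets S\<close> by (auto simp: has_cond_law_def)
      moreover have "emeasure M {\<omega>\<in>space M. Z \<omega> \<in> A \<and> X \<omega> \<in> B} = (\<integral>\<^sup>+z\<in>A. emeasure (K' z) B \<partial>distr M T Z)"
        using K' A \<open>B \<in> sets S\<close> by (auto simp: has_cond_law_def)
      ultimately show "(\<integral>\<^sup>+z\<in>A. emeasure (K z) B \<partial>distr M T Z) = (\<integral>\<^sup>+z\<in>A. emeasure (K' z) B \<partial>distr M T Z)"
        by simp
    qed auto
  qed
  then have "AE z in distr M T Z. \<forall>B\<in>G. emeasure (K z) B = emeasure (K' z) B"
    using G(1) by (simp add: AE_ball_countable)
  then show ?thesis
  proof (rule AE_mp, intro AE_I2 impI)
    fix z assume z: "z \<in> space (distr M T Z)" and eq: "\<forall>B\<in>G. emeasure (K z) B = emeasure (K' z) B"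
    then have z: "z \<in> space T" by simp
    note p = has_cond_law_kernel[OF K z] has_cond_law_kernel[OF K' z]
    interpret Kz: prob_space "K z" by fact
    show "K z = K' z"
      by (rule measure_eqI_generator_eq[OF G(2), where \<Omega> = UNIV and A = "\<lambda>_. UNIV"])
        (use eq G p S in auto)
  qed
qed

section \<open>Mutual information of the Gaussian channel\<close>

text \<open>The function \<open>f\<close> is a version of the Radon-Nikodym derivative, so the
  library's log-density is \<open>ln (f x)\<close> almost everywhere, and both its integrability and
  its integral can be computed from \<open>f\<close>.\<close>

lemma KL_eq_integral_ln_density:
  assumes Q: "sigma_finite_measure Q" and f[measurable]: "f \<in> borel_measurable Q"
    and nn: "\<And>x. 0 \<le> f x"
    and int: "integrable (density Q (\<lambda>x. ennreal (f x))) (\<lambda>x. ln (f x))"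
  shows "KL (density Q (\<lambda>x. ennreal (f x))) Q =
    ennreal (\<integral>x. ln (f x) \<partial>density Q (\<lambda>x. ennreal (f x)))"
proof -
  interpret sigma_finite_measure Q by fact
  let ?P = "density Q (\<lambda>x. ennreal (f x))"
  have ac: "absolutely_continuous Q ?P"
    by (rule absolutely_continuousI_density) measurable
  have "AE x in Q. ennreal (f x) = RN_deriv Q ?P x"
    by (rule RN_deriv_unique) auto
  \<comment> \<open>The derivative is unique up to \<open>Q\<close>-null sets, while the divergence
    integrates against \<open>?P\<close>; absolute continuity bridges the two.\<close>
  then have "AE x in ?P. ennreal (f x) = RN_deriv Q ?P x"
    by (rule absolutely_continuous_AE[OF _ ac, rotated]) simp
  then have *: "AE x in ?P. entropy_density (exp 1) Q ?P x = ln (f x)"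
  proof eventually_elim
    case (elim x)
    then show ?case using nn[of x] by (simp add: entropy_density_def log_def flip: elim)
  qed
  have m: "entropy_density (exp 1) Q ?P \<in> borel_measurable ?P" by simp
  have "integrable ?P (entropy_density (exp 1) Q ?P)"
    using int * m by (subst integrable_cong_AE[of _ _ "\<lambda>x. ln (f x)"]) auto
  moreover have "KL_divergence (exp 1) Q ?P = (\<integral>x. ln (f x) \<partial>?P)"
    unfolding KL_divergence_def using * m by (intro integral_cong_AE) auto
  ultimately show ?thesis using ac by (simp add: KL_def)
qed

section \<open>Gaussian laws: kernel measurability, variance and convolution\<close>

lemma sets_normal_law[simp, measurable_cong]: "sets (normal_law m v) = sets borel"
  by (simp add: normal_law_def)

lemma space_normal_law[simp]: "space (normal_law m v) = UNIV"
  by (simp add: normal_law_def)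

lemma normal_law_density:
  "v > 0 \<Longrightarrow> normal_law m v = density lborel (\<lambda>x. ennreal (normal_density m (sqrt v) x))"
  by (simp add: normal_law_def)

lemma prob_space_normal_law: "v \<ge> 0 \<Longrightarrow> prob_space (normal_law m v)"
  by (auto simp: normal_law_def prob_space_return intro: prob_space_normal_density)

text \<open>The probability of a fixed Borel set is the integral of a density that is jointly
  measurable in mean and point, hence measurable in the mean.\<close>

lemma measurable_normal_law:
  assumes v: "v > 0"
  shows "(\<lambda>m. normal_law m v) \<in> measurable borel (prob_algebra borel)"
proof (rule measurable_prob_algebra_generated[where \<Omega> = UNIV and G = "sets borel"])
  show "sets (borel :: real measure) = sigma_sets UNIV (sets borel)"
    using sets.sigma_sets_eq[of "borel :: real measure"] by simp
  show "Int_stable (sets (borel :: real measure))" by (auto simp: Int_stable_def)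
  fix A :: "real set" assume [measurable]: "A \<in> sets borel"
  have [measurable]: "(\<lambda>(m, x). normal_density m (sqrt v) x) \<in> borel_measurable (borel \<Otimes>\<^sub>M lborel)"
    unfolding normal_density_def by measurable
  have "(\<lambda>m. \<integral>\<^sup>+x\<in>A. ennreal (normal_density m (sqrt v) x) \<partial>lborel) \<in> borel_measurable borel"
    by measurable
  then show "(\<lambda>m. emeasure (normal_law m v) A) \<in> borel_measurable borel"
    using v by (simp add: normal_law_density emeasure_density)
qed (use v prob_space_normal_law[of v] in auto)

text \<open>The variance is kept as a nonnegative integral: it then passes through kernel mixtures
  without side conditions, and its finiteness yields integrability later.\<close>

lemma nn_integral_normal_law_variance:
  assumes v: "v > 0"
  shows "(\<integral>\<^sup>+x. ennreal ((x - m)\<^sup>2) \<partial>normal_law m v) = ennreal v"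
proof -
  have "has_bochner_integral lborel (\<lambda>x. normal_density m (sqrt v) x * (x - m)\<^sup>2) v"
    using normal_moment_even[of "sqrt v" m 1] v by simp
  then have "(\<integral>\<^sup>+x. ennreal (normal_density m (sqrt v) x * (x - m)\<^sup>2) \<partial>lborel) = ennreal v"
    by (subst nn_integral_eq_integral) (auto simp: has_bochner_integral_iff)
  then show ?thesis
    using v by (simp add: normal_law_density nn_integral_density ennreal_mult)
qed

lemma ln_normal_density:
  "v > 0 \<Longrightarrow> ln (normal_density m (sqrt v) x) = - ln (2 * pi * v) / 2 - (x - m)\<^sup>2 / (2 * v)"
  by (simp add: normal_density_def ln_mult ln_div ln_sqrt add_divide_distrib)

text \<open>This is the output law of the channel. For \<open>u > 0\<close>, Fubini turns the
  mixture into a convolution of centred densities; for \<open>u = 0\<close> the input is a point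
  mass without density, and the bind just evaluates the kernel at \<open>0\<close>.\<close>

lemma normal_law_conv:
  assumes v: "v > 0" and u: "u \<ge> 0"
  shows "normal_law 0 u \<bind> (\<lambda>x. normal_law x v) = normal_law 0 (u + v)"
proof (cases "u = 0")
  case True
  then show ?thesis
    using bind_return[OF measurable_prob_algebraD[OF measurable_normal_law[OF v]], of 0]
    by (simp add: normal_law_def)
next
  case False
  with u have u: "u > 0" by simp
  note L = measurable_prob_algebraD[OF measurable_normal_law[OF v]]
  have L': "(\<lambda>x. normal_law x v) \<in> measurable (normal_law 0 u) (subprob_algebra borel)"
    using L by (simp add: measurable_cong_sets[OF sets_normal_law refl])
  show ?thesis
  proof (rule measure_eqI)
    show "sets (normal_law 0 u \<bind> (\<lambda>x. normal_law x v)) = sets (normal_law 0 (u + v))"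
      using sets_bind_measurable[OF L'] by simp
    fix B assume "B \<in> sets (normal_law 0 u \<bind> (\<lambda>x. normal_law x v))"
    then have B[measurable]: "B \<in> sets borel" using sets_bind_measurable[OF L'] by simp
    let ?a = "normal_density 0 (sqrt u)" and ?b = "normal_density 0 (sqrt v)"
    have shift: "normal_density x (sqrt v) y = ?b (y - x)" for x y
      by (simp add: normal_density_def)
    have [measurable]: "(\<lambda>x. emeasure (normal_law x v) B) \<in> borel_measurable borel"
      by (rule measurable_emeasure_kernel[OF L B])
    have "emeasure (normal_law 0 u \<bind> (\<lambda>x. normal_law x v)) B =
        (\<integral>\<^sup>+x. emeasure (normal_law x v) B \<partial>normal_law 0 u)"
      by (rule emeasure_bind[OF _ L']) auto
    also have "\<dots> = (\<integral>\<^sup>+x. ennreal (?a x) * emeasure (normal_law x v) B \<partial>lborel)"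
      using u by (simp add: normal_law_density[of u] nn_integral_density)
    also have "\<dots> = (\<integral>\<^sup>+x. \<integral>\<^sup>+y. ennreal (?b (y - x) * ?a x) * indicator B y \<partial>lborel \<partial>lborel)"
    proof (rule nn_integral_cong)
      fix x
      have "ennreal (?a x) * emeasure (normal_law x v) B =
          ennreal (?a x) * (\<integral>\<^sup>+y. ennreal (?b (y - x)) * indicator B y \<partial>lborel)"
        using v by (simp add: normal_law_density emeasure_density shift[of x])
      also have "\<dots> = (\<integral>\<^sup>+y. ennreal (?a x) * (ennreal (?b (y - x)) * indicator B y) \<partial>lborel)"
        by (rule nn_integral_cmult[symmetric]) measurable
      also have "\<dots> = (\<integral>\<^sup>+y. ennreal (?b (y - x) * ?a x) * indicator B y \<partial>lborel)"
        by (simp add: ennreal_mult' mult_ac)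
      finally show "ennreal (?a x) * emeasure (normal_law x v) B =
          (\<integral>\<^sup>+y. ennreal (?b (y - x) * ?a x) * indicator B y \<partial>lborel)" .
    qed
    also have "\<dots> = (\<integral>\<^sup>+y. \<integral>\<^sup>+x. ennreal (?b (y - x) * ?a x) * indicator B y \<partial>lborel \<partial>lborel)"
      by (rule lborel_pair.Fubini'[symmetric]) measurable
    also have "\<dots> = (\<integral>\<^sup>+y. (\<integral>\<^sup>+x. ennreal (?b (y - x) * ?a x) \<partial>lborel) * indicator B y \<partial>lborel)"
      by (intro nn_integral_cong nn_integral_multc) measurable
    \<comment> \<open>The inner integral is the convolution of the two centred densities, whose
      variances add.\<close>
    also have "\<dots> = (\<integral>\<^sup>+y\<in>B. ennreal (normal_density 0 (sqrt (u + v)) y) \<partial>lborel)"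
      using conv_normal_density_zero_mean[of "sqrt v" "sqrt u"] u v
      by (simp add: fun_eq_iff add.commute)
    also have "\<dots> = emeasure (normal_law 0 (u + v)) B"
      using u v by (simp add: normal_law_density emeasure_density)
    finally show "emeasure (normal_law 0 u \<bind> (\<lambda>x. normal_law x v)) B = emeasure (normal_law 0 (u + v)) B" .
  qed
qed

text \<open>The ratio \<open>u / v\<close> is the signal-to-noise ratio. The computation needs a
  density of the joint law relative to the product of the marginals only, not to Lebesgue measure,
  which treats the degenerate input \<open>u = 0\<close> together with the others.\<close>

lemma mutual_info_gaussian_channel:
  assumes v: "v > 0" and u: "u \<ge> 0"
  shows "mutual_info (normal_law 0 u \<bind> (\<lambda>x. distr (normal_law x v) (borel \<Otimes>\<^sub>M borel) (Pair x))) =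
    ennreal (1/2 * ln (1 + u / v))"
proof -
  let ?A = "normal_law 0 u" and ?H = "normal_law 0 (u + v)" and ?B = "borel \<Otimes>\<^sub>M borel :: (real \<times> real) measure"
  define L where "L x = distr (normal_law x v) ?B (Pair x)" for x
  define J where "J = ?A \<bind> L"
  \<comment> \<open>Conditional density of the output divided by its marginal density; the input law
    occurs in both the joint law and the product and cancels.\<close>
  define f where "f = (\<lambda>(x, y). normal_density x (sqrt v) y / normal_density 0 (sqrt (u + v)) y)"
  have uv: "u + v > 0" using u v by simp
  interpret A: prob_space ?A using u by (rule prob_space_normal_law)
  interpret H: prob_space ?H using uv by (intro prob_space_normal_law) simp
  interpret AH: pair_prob_space ?A ?H ..
  have "L \<in> measurable borel (prob_algebra ?B)"
    unfolding L_def using measurable_normal_law[OF v] by measurable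
  then have L: "L \<in> measurable ?A (subprob_algebra ?B)"
    by (simp add: measurable_cong_sets[OF sets_normal_law refl] measurable_prob_algebraD)
  have sets_J[simp, measurable_cong]: "sets J = sets ?B"
    unfolding J_def using sets_bind_measurable[OF L] by simp
  \<comment> \<open>Integration in two stages, from which the marginals, the density and the moments
    of \<open>J\<close> are all read off.\<close>
  have nn_J: "(\<integral>\<^sup>+w. g w \<partial>J) = (\<integral>\<^sup>+x. \<integral>\<^sup>+y. g (x, y) \<partial>normal_law x v \<partial>?A)"
    if [measurable]: "g \<in> borel_measurable ?B" for g
    unfolding J_def L_def
    by (subst nn_integral_bind[OF that L[unfolded L_def]]) (simp add: nn_integral_distr)
  have [measurable]: "f \<in> borel_measurable ?B"
    unfolding f_def normal_density_def by measurable
  have sets_AH[simp, measurable_cong]: "sets (?A \<Otimes>\<^sub>M ?H) = sets ?B"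
    by (intro sets_pair_measure_cong) auto
  have f_nonneg: "0 \<le> f w" for w by (cases w) (simp add: f_def)
  have J_fst: "distr J borel fst = ?A"
  proof (rule measure_eqI)
    fix X assume "X \<in> sets (distr J borel fst)"
    then have [measurable]: "X \<in> sets borel" by simp
    have "emeasure (distr J borel fst) X = (\<integral>\<^sup>+w. indicator X (fst w) \<partial>J)"
      using nn_integral_distr[of fst J borel "indicator X"] by simp
    also have "\<dots> = (\<integral>\<^sup>+x. \<integral>\<^sup>+y. indicator X x \<partial>normal_law x v \<partial>?A)"
      by (subst nn_J) auto
    also have "\<dots> = emeasure ?A X"
      using v prob_space.emeasure_space_1[OF prob_space_normal_law[of v]] by simp
    finally show "emeasure (distr J borel fst) X = emeasure ?A X" .
  qed simp
  have J_snd: "distr J borel snd = ?H"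
  proof (rule measure_eqI)
    fix X assume "X \<in> sets (distr J borel snd)"
    then have [measurable]: "X \<in> sets borel" by simp
    have "emeasure (distr J borel snd) X = (\<integral>\<^sup>+w. indicator X (snd w) \<partial>J)"
      using nn_integral_distr[of snd J borel "indicator X"] by simp
    also have "\<dots> = (\<integral>\<^sup>+x. emeasure (normal_law x v) X \<partial>?A)"
      by (subst nn_J) auto
    also have "\<dots> = emeasure (?A \<bind> (\<lambda>x. normal_law x v)) X"
      using measurable_prob_algebraD[OF measurable_normal_law[OF v]]
      by (intro emeasure_bind[symmetric, where N=borel]) (auto cong: measurable_cong_sets)
    finally show "emeasure (distr J borel snd) X = emeasure ?H X"
      by (simp add: normal_law_conv[OF v u])
  qed simp
  have J_density: "density (?A \<Otimes>\<^sub>M ?H) (\<lambda>w. ennreal (f w)) = J"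
  proof (rule measure_eqI)
    show "sets (density (?A \<Otimes>\<^sub>M ?H) (\<lambda>w. ennreal (f w))) = sets J"
      by simp
    fix X assume "X \<in> sets (density (?A \<Otimes>\<^sub>M ?H) (\<lambda>w. ennreal (f w)))"
    then have [measurable]: "X \<in> sets ?B" by simp
    have "emeasure (density (?A \<Otimes>\<^sub>M ?H) (\<lambda>w. ennreal (f w))) X =
        (\<integral>\<^sup>+x. \<integral>\<^sup>+y. ennreal (f (x, y)) * indicator X (x, y) \<partial>?H \<partial>?A)"
      using H.nn_integral_fst[of "\<lambda>w. ennreal (f w) * indicator X w" ?A]
      by (subst emeasure_density) simp_all
    also have "\<dots> = (\<integral>\<^sup>+x. \<integral>\<^sup>+y. indicator X (x, y) \<partial>normal_law x v \<partial>?A)"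
    proof (rule nn_integral_cong)
      fix x
      have "(\<integral>\<^sup>+y. ennreal (f (x, y)) * indicator X (x, y) \<partial>?H) =
          (\<integral>\<^sup>+y. ennreal (normal_density 0 (sqrt (u + v)) y) * (ennreal (f (x, y)) * indicator X (x, y)) \<partial>lborel)"
        using uv by (simp add: normal_law_density nn_integral_density)
      also have "\<dots> = (\<integral>\<^sup>+y. ennreal (normal_density x (sqrt v) y) * indicator X (x, y) \<partial>lborel)"
      proof (rule nn_integral_cong)
        fix y
        \<comment> \<open>Strict positivity of the marginal density lets it cancel the denominator
          of \<open>f\<close>.\<close>
        have "normal_density 0 (sqrt (u + v)) y > 0" using uv by (intro normal_density_pos) simp
        then show "ennreal (normal_density 0 (sqrt (u + v)) y) * (ennreal (f (x, y)) * indicator X (x, y)) =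
            ennreal (normal_density x (sqrt v) y) * indicator X (x, y)"
          by (simp add: f_def ennreal_mult'[symmetric] mult.assoc[symmetric])
      qed
      also have "\<dots> = (\<integral>\<^sup>+y. indicator X (x, y) \<partial>normal_law x v)"
        using v by (simp add: normal_law_density nn_integral_density)
      finally show "(\<integral>\<^sup>+y. ennreal (f (x, y)) * indicator X (x, y) \<partial>?H) =
          (\<integral>\<^sup>+y. indicator X (x, y) \<partial>normal_law x v)" .
    qed
    also have "\<dots> = (\<integral>\<^sup>+w. indicator X w \<partial>J)" by (subst nn_J) auto
    finally show "emeasure (density (?A \<Otimes>\<^sub>M ?H) (\<lambda>w. ennreal (f w))) X = emeasure J X" by simp
  qed
  \<comment> \<open>Around its mean \<open>x\<close> the output has variance \<open>v\<close>
    whatever \<open>x\<close> is, so averaging over the probability measure \<open>?A\<close> leaves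
    \<open>v\<close>.\<close>
  have noise: "(\<integral>\<^sup>+w. ennreal ((snd w - fst w)\<^sup>2) \<partial>J) = ennreal v"
    using v by (subst nn_J) (auto simp: nn_integral_normal_law_variance A.emeasure_space_1[simplified])
  have "(\<integral>\<^sup>+w. ennreal ((snd w)\<^sup>2) \<partial>J) = (\<integral>\<^sup>+y. ennreal (y\<^sup>2) \<partial>distr J borel snd)"
    by (subst nn_integral_distr) auto
  then have second_moment: "(\<integral>\<^sup>+w. ennreal ((snd w)\<^sup>2) \<partial>J) = ennreal (u + v)"
    using nn_integral_normal_law_variance[OF uv, of 0] by (simp add: J_snd)
  have int1: "integrable J (\<lambda>w. (snd w - fst w)\<^sup>2)" "integrable J (\<lambda>w. (snd w)\<^sup>2)"
    using noise second_moment by (auto intro!: integrableI_nn_integral_finite)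
  have val1: "(\<integral>w. (snd w - fst w)\<^sup>2 \<partial>J) = v" "(\<integral>w. (snd w)\<^sup>2 \<partial>J) = u + v"
    using noise second_moment u v by (auto simp: integral_eq_nn_integral)
  interpret J: prob_space J
    using J_fst A.prob_space_axioms by (intro prob_space_distrD[of fst J borel]) auto
  \<comment> \<open>The logarithmic term comes from the normalizing constants of the two densities,
    the quadratic terms from their exponents.\<close>
  have ln_f: "ln (f w) = 1/2 * ln (1 + u / v) - (snd w - fst w)\<^sup>2 / (2 * v) + (snd w)\<^sup>2 / (2 * (u + v))" for w
  proof -
    obtain x y where w: "w = (x, y)" by (cases w)
    have "normal_density 0 (sqrt (u + v)) y > 0" "normal_density x (sqrt v) y > 0"
      using uv v by (auto intro: normal_density_pos)
    then have "ln (f w) = ln (normal_density x (sqrt v) y) - ln (normal_density 0 (sqrt (u + v)) y)"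
      by (simp add: f_def w ln_div)
    moreover have "ln (1 + u / v) = ln (2 * pi * (u + v)) - ln (2 * pi * v)"
    proof -
      have "1 + u / v = (2 * pi * (u + v)) / (2 * pi * v)" using v by (simp add: field_simps)
      also have "ln \<dots> = ln (2 * pi * (u + v)) - ln (2 * pi * v)"
        using v uv by (intro ln_divide_pos) auto
      finally show ?thesis .
    qed
    ultimately show ?thesis
      using v uv by (simp add: ln_normal_density w diff_divide_distrib)
  qed
  have int: "integrable J (\<lambda>w. ln (f w))"
    unfolding ln_f using int1 by auto
  \<comment> \<open>The quadratic terms have expectations \<open>v / (2 * v)\<close> and
    \<open>(u + v) / (2 * (u + v))\<close>, both equal to 1/2, and enter with opposite
    signs.\<close>
  have val: "(\<integral>w. ln (f w) \<partial>J) = 1/2 * ln (1 + u / v)"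
    unfolding ln_f using int1 val1 v uv by (simp add: J.prob_space)
  have "mutual_info J = KL J (?A \<Otimes>\<^sub>M ?H)"
    by (simp add: mutual_info_def J_fst J_snd)
  also have "\<dots> = ennreal (\<integral>w. ln (f w) \<partial>J)"
    using KL_eq_integral_ln_density[of "?A \<Otimes>\<^sub>M ?H" f] AH.sigma_finite_measure_axioms f_nonneg int
    by (simp add: J_density)
  finally show ?thesis
    unfolding val unfolding J_def L_def .
qed

section \<open>Logarithmic moments from polynomial tails\<close>

text \<open>A layer-cake argument started at \<open>t0\<close>, since the tail is controlled only
  from there on. In nonnegative integrals Fubini applies before integrability is known, and the
  finite bound then provides it.\<close>

lemma nn_integral_ln_tail:
  fixes lam :: "'a \<Rightarrow> real"
  assumes "prob_space M" and [measurable]: "lam \<in> borel_measurable M"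
    and nn: "AE \<omega> in M. 0 \<le> lam \<omega>"
    and \<alpha>: "\<alpha> > 0" and t0: "t0 \<ge> 1" and C: "C > 0"
    and tail: "\<And>t. t \<ge> t0 \<Longrightarrow> measure M {\<omega>\<in>space M. lam \<omega> \<ge> t} \<le> C * t powr (-\<alpha>)"
  shows "(\<integral>\<^sup>+\<omega>. ennreal (ln (1 + (lam \<omega>)\<^sup>2)) \<partial>M) \<le>
    ennreal (ln (1 + t0\<^sup>2) + 2 * C / \<alpha> * t0 powr (-\<alpha>))"
proof -
  interpret prob_space M by fact
  interpret pair_sigma_finite M lborel ..
  \<comment> \<open>Integrating over \<open>t\<close> gives the integral of \<open>2 / t\<close>
    from \<open>t0\<close> to \<open>lam \<omega>\<close>; integrating over \<open>\<omega>\<close>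
    gives a tail probability weighted by \<open>2 / t\<close>.\<close>
  define g :: "'a \<Rightarrow> real \<Rightarrow> ennreal" where
    "g \<omega> t = ennreal (2 / t) * indicator {t0..} t * indicator {\<omega>\<in>space M. t \<le> lam \<omega>} \<omega>" for \<omega> t
  \<comment> \<open>As a condition on the pair of \<open>\<omega>\<close> and \<open>t\<close>, the
    varying event is visibly jointly measurable; both forms agree on the space.\<close>
  have g_eq: "(\<lambda>(\<omega>, t). ennreal (2 / t) * indicator {t0..} t * (if t \<le> lam \<omega> then 1 else 0)) \<in> borel_measurable (M \<Otimes>\<^sub>M lborel)"
    by measurable
  have g[measurable]: "case_prod g \<in> borel_measurable (M \<Otimes>\<^sub>M lborel)"
    using g_eq by (rule measurable_cong[THEN iffD1, rotated])
      (auto simp: g_def space_pair_measure split: split_indicator)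
  have le: "ennreal (ln (1 + (lam \<omega>)\<^sup>2)) \<le> ennreal (ln (1 + t0\<^sup>2)) + (\<integral>\<^sup>+t. g \<omega> t \<partial>lborel)"
    if "\<omega> \<in> space M" "0 \<le> lam \<omega>" for \<omega>
  proof (cases "lam \<omega> \<le> t0")
    case True
    then have "ln (1 + (lam \<omega>)\<^sup>2) \<le> ln (1 + t0\<^sup>2)"
      using that by (subst ln_le_cancel_iff) (auto intro!: power_mono add_pos_nonneg)
    then show ?thesis by (intro add_increasing2) (auto intro: ennreal_leI)
  next
    case False
    let ?x = "lam \<omega>"
    have "(\<integral>\<^sup>+t. g \<omega> t \<partial>lborel) = (\<integral>\<^sup>+t. ennreal (2 / t) * indicator {t0..?x} t \<partial>lborel)"
      using that by (intro nn_integral_cong) (auto simp: g_def split: split_indicator)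
    also have "\<dots> = ennreal (2 * ln ?x - 2 * ln t0)"
      using t0 False
      by (intro nn_integral_FTC_Icc) (auto intro!: derivative_eq_intros simp: divide_inverse)
    finally have I: "(\<integral>\<^sup>+t. g \<omega> t \<partial>lborel) = ennreal (2 * ln ?x - 2 * ln t0)" .
    have "1 * t0\<^sup>2 \<le> 1 * ?x\<^sup>2" using False t0 by (auto intro!: power_mono)
    \<comment> \<open>Cross-multiplied form of the fact that
      \<open>(1 + x\<^sup>2) / x\<^sup>2\<close> decreases for positive \<open>x\<close>; its
      logarithm compares the growth of \<open>ln (1 + x\<^sup>2)\<close> with that of
      \<open>2 * ln x\<close>.\<close>
    then have "(1 + ?x\<^sup>2) * t0\<^sup>2 \<le> (1 + t0\<^sup>2) * ?x\<^sup>2" by (simp add: algebra_simps)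
    then have "ln ((1 + ?x\<^sup>2) * t0\<^sup>2) \<le> ln ((1 + t0\<^sup>2) * ?x\<^sup>2)"
      using t0 False by (subst ln_le_cancel_iff) (auto intro!: mult_pos_pos add_pos_nonneg)
    moreover have "1 + y\<^sup>2 > 0" for y :: real by (auto intro: add_pos_nonneg)
    ultimately have "ln (1 + ?x\<^sup>2) + 2 * ln t0 \<le> ln (1 + t0\<^sup>2) + 2 * ln ?x"
      using t0 False by (simp add: ln_mult_pos ln_realpow)
    then have "ln (1 + ?x\<^sup>2) \<le> ln (1 + t0\<^sup>2) + (2 * ln ?x - 2 * ln t0)" by simp
    moreover have "ln t0 \<le> ln ?x" using t0 False by simp
    ultimately show ?thesis
      unfolding I by (subst ennreal_plus[symmetric]) (simp_all add: ennreal_leI del: ennreal_plus)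
  qed
  have bound: "(\<integral>\<^sup>+\<omega>. g \<omega> t \<partial>M) \<le> ennreal (2 * C * t powr (-\<alpha> - 1)) * indicator {t0..} t" for t
  proof (cases "t0 \<le> t")
    case True
    have "(\<integral>\<^sup>+\<omega>. g \<omega> t \<partial>M) = ennreal (2 / t) * emeasure M {\<omega>\<in>space M. t \<le> lam \<omega>}"
      unfolding g_def using True by (simp add: nn_integral_cmult)
    also have "\<dots> \<le> ennreal (2 / t) * ennreal (C * t powr (-\<alpha>))"
      using tail[OF True] by (intro mult_left_mono) (auto simp: emeasure_eq_measure intro: ennreal_leI)
    also have "\<dots> = ennreal (2 * C * t powr (-\<alpha> - 1))"
      using True t0 C by (simp add: ennreal_mult'[symmetric] powr_diff field_simps)
    finally show ?thesis using True by simp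
  qed (simp add: g_def)
  have "(\<integral>\<^sup>+\<omega>. \<integral>\<^sup>+t. g \<omega> t \<partial>lborel \<partial>M) = (\<integral>\<^sup>+t. \<integral>\<^sup>+\<omega>. g \<omega> t \<partial>M \<partial>lborel)"
    using Fubini'[of g] by simp
  also have "\<dots> \<le> (\<integral>\<^sup>+t. ennreal (2 * C * t powr (-\<alpha> - 1)) * indicator {t0..} t \<partial>lborel)"
    by (intro nn_integral_mono bound)
  \<comment> \<open>The antiderivative vanishes at infinity because \<open>\<alpha> > 0\<close>, so
    only its value at \<open>t0\<close> survives; this produces the factor
    \<open>2 * C / \<alpha>\<close>.\<close>
  also have "\<dots> = ennreal (0 - (- (2 * C / \<alpha>) * t0 powr (-\<alpha>)))"
  proof (rule nn_integral_FTC_atLeast)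
    fix t assume "t0 \<le> t"
    then show "((\<lambda>t. - (2 * C / \<alpha>) * t powr (-\<alpha>)) has_real_derivative 2 * C * t powr (-\<alpha> - 1)) (at t)"
      using t0 \<alpha> by (auto intro!: derivative_eq_intros)
    show "0 \<le> 2 * C * t powr (-\<alpha> - 1)" using C by simp
  next
    have "((\<lambda>t. - (2 * C / \<alpha>) * t powr (-\<alpha>)) \<longlongrightarrow> - (2 * C / \<alpha>) * 0) at_top"
      using \<alpha> by (intro tendsto_intros tendsto_neg_powr filterlim_ident) auto
    then show "((\<lambda>t. - (2 * C / \<alpha>) * t powr (-\<alpha>)) \<longlongrightarrow> 0) at_top" by simp
  qed measurable
  finally have G: "(\<integral>\<^sup>+\<omega>. \<integral>\<^sup>+t. g \<omega> t \<partial>lborel \<partial>M) \<le> ennreal (2 * C / \<alpha> * t0 powr (-\<alpha>))" by simp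
  have "(\<integral>\<^sup>+\<omega>. ennreal (ln (1 + (lam \<omega>)\<^sup>2)) \<partial>M) \<le>
      (\<integral>\<^sup>+\<omega>. ennreal (ln (1 + t0\<^sup>2)) + (\<integral>\<^sup>+t. g \<omega> t \<partial>lborel) \<partial>M)"
  proof (rule nn_integral_mono_AE)
    show "AE \<omega> in M. ennreal (ln (1 + (lam \<omega>)\<^sup>2)) \<le> ennreal (ln (1 + t0\<^sup>2)) + (\<integral>\<^sup>+t. g \<omega> t \<partial>lborel)"
      using nn AE_space by eventually_elim (rule le)
  qed
  also have "\<dots> = ennreal (ln (1 + t0\<^sup>2)) + (\<integral>\<^sup>+\<omega>. \<integral>\<^sup>+t. g \<omega> t \<partial>lborel \<partial>M)"
    by (subst nn_integral_add) (auto simp: emeasure_space_1)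
  also have "\<dots> \<le> ennreal (ln (1 + t0\<^sup>2)) + ennreal (2 * C / \<alpha> * t0 powr (-\<alpha>))"
    using G by (intro add_left_mono)
  also have "\<dots> = ennreal (ln (1 + t0\<^sup>2) + 2 * C / \<alpha> * t0 powr (-\<alpha>))"
    using C \<alpha> by (intro ennreal_plus[symmetric]) auto
  finally show ?thesis .
qed

lemma ln_scale_le:
  fixes c x :: real
  assumes "c > 0"
  shows "ln (1 + c * x\<^sup>2) \<le> ln (1 + c) + ln (1 + x\<^sup>2)"
proof -
  have p: "1 + c * x\<^sup>2 > 0" "1 + x\<^sup>2 > 0" using assms by (auto intro: add_pos_nonneg)
  have "1 + c * x\<^sup>2 \<le> (1 + c) * (1 + x\<^sup>2)" using assms by (simp add: algebra_simps)
  then have "ln (1 + c * x\<^sup>2) \<le> ln ((1 + c) * (1 + x\<^sup>2))" using p by simp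
  then show ?thesis using assms p by (simp add: ln_mult_pos)
qed

text \<open>The finite nonnegative integral settles the case without \<open>c\<close>; for general
  \<open>c\<close> the nonnegative integrand is dominated by that one plus the constant
  \<open>ln (1 + c)\<close>.\<close>

lemma ln_moment_bound:
  fixes lam :: "'a \<Rightarrow> real"
  assumes M: "prob_space M" and lam[measurable]: "lam \<in> borel_measurable M"
    and nn: "AE \<omega> in M. 0 \<le> lam \<omega>"
    and \<alpha>: "\<alpha> > 0" and t0: "t0 \<ge> 1" and C: "C > 0"
    and tail: "\<And>t. t \<ge> t0 \<Longrightarrow> measure M {\<omega>\<in>space M. lam \<omega> \<ge> t} \<le> C * t powr (-\<alpha>)"
  shows "integrable M (\<lambda>\<omega>. ln (1 + (lam \<omega>)\<^sup>2))"
    and "c > 0 \<Longrightarrow> integrable M (\<lambda>\<omega>. ln (1 + c * (lam \<omega>)\<^sup>2))"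
    and "c > 0 \<Longrightarrow> (\<integral>\<omega>. ln (1 + c * (lam \<omega>)\<^sup>2) \<partial>M)
           \<le> ln (1 + c) + ln (1 + t0\<^sup>2) + 2 * C / \<alpha> * t0 powr (-\<alpha>)"
proof -
  interpret prob_space M by fact
  note tl = nn_integral_ln_tail[OF assms]
  show int: "integrable M (\<lambda>\<omega>. ln (1 + (lam \<omega>)\<^sup>2))"
    using tl by (intro integrableI_nonneg) (auto intro: le_less_trans)
  have "ennreal (\<integral>\<omega>. ln (1 + (lam \<omega>)\<^sup>2) \<partial>M) \<le> ennreal (ln (1 + t0\<^sup>2) + 2 * C / \<alpha> * t0 powr (-\<alpha>))"
    using tl by (subst nn_integral_eq_integral[symmetric, OF int]) auto
  then have le: "(\<integral>\<omega>. ln (1 + (lam \<omega>)\<^sup>2) \<partial>M) \<le> ln (1 + t0\<^sup>2) + 2 * C / \<alpha> * t0 powr (-\<alpha>)"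
    using C \<alpha> by (subst (asm) ennreal_le_iff) auto
  assume c: "c > 0"
  show int': "integrable M (\<lambda>\<omega>. ln (1 + c * (lam \<omega>)\<^sup>2))"
  proof (rule Bochner_Integration.integrable_bound)
    show "integrable M (\<lambda>\<omega>. ln (1 + c) + ln (1 + (lam \<omega>)\<^sup>2))" using int by simp
    show "AE \<omega> in M. norm (ln (1 + c * (lam \<omega>)\<^sup>2)) \<le> norm (ln (1 + c) + ln (1 + (lam \<omega>)\<^sup>2))"
      using c ln_scale_le[OF c] by (intro AE_I2) simp
  qed measurable
  have "(\<integral>\<omega>. ln (1 + c * (lam \<omega>)\<^sup>2) \<partial>M) \<le> (\<integral>\<omega>. ln (1 + c) + ln (1 + (lam \<omega>)\<^sup>2) \<partial>M)"
    using int int' ln_scale_le[OF c] by (intro integral_mono) auto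
  also have "\<dots> = ln (1 + c) + (\<integral>\<omega>. ln (1 + (lam \<omega>)\<^sup>2) \<partial>M)"
    using int by (simp add: prob_space)
  finally show "(\<integral>\<omega>. ln (1 + c * (lam \<omega>)\<^sup>2) \<partial>M)
      \<le> ln (1 + c) + ln (1 + t0\<^sup>2) + 2 * C / \<alpha> * t0 powr (-\<alpha>)"
    using le by simp
qed

section \<open>Conditional mutual information of the scale mixture\<close>

text \<open>The definition selects an arbitrary version of the conditional law. The given
  \<open>K\<close> shows that one exists, and almost sure uniqueness lets \<open>K\<close> replace
  the selected version under the integral.\<close>

lemma cond_mutual_info_eq:
  assumes M: "prob_space M"
    and K: "has_cond_law M (borel \<Otimes>\<^sub>M borel) (\<lambda>\<omega>. (X \<omega>, Y \<omega>)) borel Z K"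
  shows "cond_mutual_info M X Y Z = (\<integral>\<^sup>+z. mutual_info (K z) \<partial>distr M borel Z)"
proof -
  let ?P = "has_cond_law M (borel \<Otimes>\<^sub>M borel) (\<lambda>\<omega>. (X \<omega>, Y \<omega>)) borel Z"
  have "?P (Eps ?P)" using K by (rule someI[of ?P])
  moreover have "sets (borel \<Otimes>\<^sub>M borel :: (real \<times> real) measure) = sets borel"
    by (subst borel_prod) (rule refl)
  ultimately have "AE z in distr M borel Z. Eps ?P z = K z"
    using K by (intro has_cond_law_unique[OF M])
  then show ?thesis
    unfolding cond_mutual_info_def Let_def by (intro nn_integral_cong_AE) auto
qed

text \<open>Composing prior and noise kernels gives a version of the conditional law. The channel
  formula then applies for every real \<open>z\<close>, with \<open>u = z\<^sup>2\<close> and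
  \<open>v = \<sigma>\<^sup>2 / n\<close>.\<close>

lemma cond_mutual_info_scale_mixture:
  assumes model: "scale_mixture_model N l \<theta> Y \<sigma> n"
  shows "cond_mutual_info N \<theta> Y l =
    (\<integral>\<^sup>+z. ennreal (1/2 * ln (1 + n / \<sigma>\<^sup>2 * z\<^sup>2)) \<partial>distr N borel l)"
proof -
  have N: "prob_space N" and \<sigma>: "\<sigma> > 0" and n: "n > 0"
    and K: "has_cond_law N borel \<theta> borel l (\<lambda>l. normal_law 0 (l\<^sup>2))"
    and L: "has_cond_law N borel Y (borel \<Otimes>\<^sub>M borel) (\<lambda>\<omega>. (\<theta> \<omega>, l \<omega>)) (\<lambda>(t, l). normal_law t (\<sigma>\<^sup>2 / n))"
    using model by (auto simp: scale_mixture_model_def)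
  have "cond_mutual_info N \<theta> Y l = (\<integral>\<^sup>+z. mutual_info (normal_law 0 (z\<^sup>2) \<bind>
      (\<lambda>x. distr (normal_law x (\<sigma>\<^sup>2 / n)) (borel \<Otimes>\<^sub>M borel) (Pair x))) \<partial>distr N borel l)"
    using cond_mutual_info_eq[OF N has_cond_law_compose[OF N K L]] by simp
  also have "\<dots> = (\<integral>\<^sup>+z. ennreal (1/2 * ln (1 + n / \<sigma>\<^sup>2 * z\<^sup>2)) \<partial>distr N borel l)"
    using \<sigma> n by (intro nn_integral_cong) (simp add: mutual_info_gaussian_channel mult.commute)
  finally show ?thesis .
qed

text \<open>The model may live on a space other than that of \<open>lam\<close>, linked only through
  the law of the scale. In the growth statement the space, the noise level and \<open>n\<close> may
  all vary along an arbitrary filter while that law stays fixed, so the bound depends on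
  \<open>c\<close> alone.\<close>

theorem lemma2:
  fixes M :: "'a measure" and lam :: "'a \<Rightarrow> real" and \<alpha> t0 C :: real
  assumes "prob_space M"
    and "lam \<in> borel_measurable M"
    and "AE \<omega> in M. 0 \<le> lam \<omega>"
    and "\<alpha> > 0" and "t0 \<ge> 1" and "C > 0"
    and "\<And>t. t \<ge> t0 \<Longrightarrow> measure M {\<omega>\<in>space M. lam \<omega> \<ge> t} \<le> C * t powr (-\<alpha>)"
  shows "integrable M (\<lambda>\<omega>. ln (1 + (lam \<omega>)\<^sup>2)) \<and>
    (\<forall>c>0. integrable M (\<lambda>\<omega>. ln (1 + c * (lam \<omega>)\<^sup>2)) \<and>
       (\<integral>\<omega>. ln (1 + c * (lam \<omega>)\<^sup>2) \<partial>M)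
         \<le> ln (1 + c) + ln (1 + t0\<^sup>2) + 2 * C / \<alpha> * t0 powr (-\<alpha>)) \<and>
    (\<forall>(N :: 'b measure) l \<theta> Y \<sigma> n.
       scale_mixture_model N l \<theta> Y \<sigma> n \<and> distr N borel l = distr M borel lam \<longrightarrow>
       cond_mutual_info N \<theta> Y l = ennreal (1/2 * (\<integral>\<omega>. ln (1 + n / \<sigma>\<^sup>2 * (lam \<omega>)\<^sup>2) \<partial>M)) \<and>
       cond_mutual_info N \<theta> Y l < \<infinity>) \<and>
    (\<forall>(F :: 'i filter) (N :: 'i \<Rightarrow> 'b measure) l \<theta> Y \<sigma> n.
       (\<forall>i. scale_mixture_model (N i) (l i) (\<theta> i) (Y i) (\<sigma> i) (n i) \<and>
            distr (N i) borel (l i) = distr M borel lam) \<and>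
       filterlim (\<lambda>i. n i / (\<sigma> i)\<^sup>2) at_top F \<longrightarrow>
       (\<lambda>i. enn2real (cond_mutual_info (N i) (\<theta> i) (Y i) (l i)))
         \<in> O[F](\<lambda>i. ln (n i / (\<sigma> i)\<^sup>2)))"
proof -
  note [measurable] = assms(2)
  define I where "I c = (\<integral>\<omega>. ln (1 + c * (lam \<omega>)\<^sup>2) \<partial>M)" for c
  \<comment> \<open>The part of the moment bound that does not depend on \<open>c\<close>.\<close>
  define D where "D = ln (1 + t0\<^sup>2) + 2 * C / \<alpha> * t0 powr (-\<alpha>)"
  have D: "D \<ge> 0" using assms(4,6) by (simp add: D_def)
  have I_nonneg: "I c \<ge> 0" if "c > 0" for c
    using that by (auto simp: I_def intro!: integral_nonneg_AE)
  have int: "integrable M (\<lambda>\<omega>. ln (1 + (lam \<omega>)\<^sup>2))"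
    by (rule ln_moment_bound(1)[OF assms])
  have int_c: "integrable M (\<lambda>\<omega>. ln (1 + c * (lam \<omega>)\<^sup>2))" if "c > 0" for c
    by (rule ln_moment_bound(2)[OF assms, OF _ that])
  have I_le: "I c \<le> ln (1 + c) + D" if "c > 0" for c
    unfolding I_def D_def add.assoc[symmetric] by (rule ln_moment_bound(3)[OF assms, OF _ that])
  have info: "cond_mutual_info N \<theta> Y l = ennreal (1/2 * I (n / \<sigma>\<^sup>2))"
    if model: "scale_mixture_model N l \<theta> Y \<sigma> n" and eq: "distr N borel l = distr M borel lam"
    for N :: "'b measure" and l \<theta> Y \<sigma> n
  proof -
    have c: "n / \<sigma>\<^sup>2 > 0" using model by (simp add: scale_mixture_model_def)
    have "cond_mutual_info N \<theta> Y l = (\<integral>\<^sup>+\<omega>. ennreal (1/2 * ln (1 + n / \<sigma>\<^sup>2 * (lam \<omega>)\<^sup>2)) \<partial>M)"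
      unfolding cond_mutual_info_scale_mixture[OF model] eq by (subst nn_integral_distr) auto
    also have "\<dots> = ennreal (\<integral>\<omega>. 1/2 * ln (1 + n / \<sigma>\<^sup>2 * (lam \<omega>)\<^sup>2) \<partial>M)"
      using int_c[OF c] c by (intro nn_integral_eq_integral) (simp_all del: times_divide_eq_left)
    finally show ?thesis by (simp add: I_def)
  qed
  have growth: "(\<lambda>i. enn2real (cond_mutual_info (N i) (\<theta> i) (Y i) (l i))) \<in> O[F](\<lambda>i. ln (n i / (\<sigma> i)\<^sup>2))"
    if model: "\<forall>i. scale_mixture_model (N i) (l i) (\<theta> i) (Y i) (\<sigma> i) (n i) \<and>
        distr (N i) borel (l i) = distr M borel lam"
      and lim: "filterlim (\<lambda>i. n i / (\<sigma> i)\<^sup>2) at_top F"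
    for F :: "'i filter" and N :: "'i \<Rightarrow> 'b measure" and l \<theta> Y \<sigma> n
  proof (rule bigoI)
    \<comment> \<open>The threshold 3 exceeds \<open>exp 1\<close>, so that \<open>ln ?c\<close> is
      at least 1, and it also ensures \<open>1 + ?c \<le> ?c * ?c\<close>.\<close>
    have "eventually (\<lambda>i. n i / (\<sigma> i)\<^sup>2 \<ge> 3) F"
      using lim by (simp add: filterlim_at_top)
    \<comment> \<open>The constant is half of \<open>2 + D\<close>: the term
      \<open>ln (1 + ?c)\<close> costs at most \<open>2 * ln ?c\<close>, and \<open>D\<close> at
      most \<open>D * ln ?c\<close>.\<close>
    then show "\<forall>\<^sub>F i in F. norm (enn2real (cond_mutual_info (N i) (\<theta> i) (Y i) (l i)))
        \<le> (1 + D / 2) * norm (ln (n i / (\<sigma> i)\<^sup>2))"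
    proof eventually_elim
      case (elim i)
      let ?c = "n i / (\<sigma> i)\<^sup>2"
      have "exp 1 \<le> ?c" using exp_le elim by simp
      then have ln1: "1 \<le> ln ?c" using elim by (subst ln_ge_iff) auto
      have "1 + ?c \<le> ?c * ?c" using elim mult_right_mono[of 3 ?c ?c] by linarith
      then have "ln (1 + ?c) \<le> ln (?c * ?c)" using elim by (subst ln_le_cancel_iff) auto
      also have "ln (?c * ?c) = 2 * ln ?c" using ln_mult_pos[of ?c ?c] elim by linarith
      finally have "ln (1 + ?c) \<le> 2 * ln ?c" .
      moreover have "D * 1 \<le> D * ln ?c" using D ln1 by (intro mult_left_mono)
      ultimately have "I ?c \<le> 2 * ln ?c + D * ln ?c" using I_le[of ?c] elim by linarith
      moreover have "enn2real (cond_mutual_info (N i) (\<theta> i) (Y i) (l i)) = 1/2 * I ?c"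
        using info[of "N i" "l i" "\<theta> i" "Y i" "\<sigma> i" "n i"] model I_nonneg[of ?c] elim by simp
      ultimately show ?case using I_nonneg[of ?c] ln1 elim by (simp add: algebra_simps)
    qed
  qed
  show ?thesis
  proof (intro conjI allI impI, goal_cases)
    case 1
    show ?case by (rule int)
  next
    case (2 c)
    then show ?case by (rule int_c)
  next
    case (3 c)
    then show ?case using I_le[of c] by (simp add: I_def D_def)
  next
    case (4 N l \<theta> Y \<sigma> n)
    then show ?case using info[of N l \<theta> Y \<sigma> n] by (simp add: I_def)
  next
    case (5 N l \<theta> Y \<sigma> n)
    then show ?case using info[of N l \<theta> Y \<sigma> n] by simp
  next
    case (6 F N l \<theta> Y \<sigma> n)
    then show ?case by (intro growth) auto
  qed
qed

end
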